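(* Let $a>0$ and $b>0$, and for each integer $n\ge 1$ let $\kappa_n(a,b)$ be the $n$-th cumulant of a random variable $X\sim\mathrm{BE}(a,b)$ (beta-exponential distribution with parameters $a$ and $b$). Define, for integers $n\geq 1$, $$f_{\mathrm{BE}}(n,a,b)=\left(\frac{\kappa_n(a,b)}{(n-1)!}\right)^{\frac1n}.$$ Then, for any $b>0$, the function $n\mapsto f_{\mathrm{BE}}(n,a,b)$ on $\mathbb{N}\setminus\{0\}$ is increasing if $0<a<1$, decreasing if $a>1$, and constantly equal to $\frac1b$ if $a=1$.
   Context: A random variable $X$ has the beta-exponential distribution $\mathrm{BE}(a,b)$, $a,b>0$, if $X=-\ln(1-V)$ where $V$ is a beta random variable with parameters $a$ and $b$; equivalently, $X$ has density $g(x;a,b)=\frac{1}{B(a,b)}(1-\mathrm{e}^{-x})^{a-1}\mathrm{e}^{-bx}\mathbf{1}_{(0,+\infty)}(x)$, where $B(a,b)=\int_0^{+\infty}(1-\mathrm{e}^{-x})^{a-1}\mathrm{e}^{-bx}\,\mathrm{d}x$ is the beta function. Its cumulant-generating function is $K(t)=\ln\mathbb{E}(\exp(tX))=\ln\Gamma(a+b)+\ln\Gamma(b-t)-\ln\Gamma(b)-\ln\Gamma(a+b-t)$ for $t<b$, and its $n$-th cumulant is $\kappa_n(a,b)=K^{(n)}(0)=(-1)^n\left(\psi^{(n-1)}(b)-\psi^{(n-1)}(b+a)\right)$, where $\psi^{(m)}$ is the polygamma function of order $m$ (the derivative of order $m+1$ of $\ln\Gamma$). "Increasing" and "decreasing"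 are meant strictly: $h$ is increasing (resp. decreasing) if $x<y$ implies $h(x)<h(y)$ (resp. $h(x)>h(y)$). *)

theory Defs
  imports "HOL-Probability.Probability"
begin

definition beta_exponential_density :: "real \<Rightarrow> real \<Rightarrow> real \<Rightarrow> real" where
  "beta_exponential_density a b x =
     (1 / Beta a b) * (1 - exp (- x)) powr (a - 1) * exp (- b * x) * indicator {0<..} x"

text \<open>
  The Bochner integral is 0 for a non-integrable function, so the value below at \<open>t\<close> is the
  logarithm of the moment-generating function only where \<open>exp (t * X)\<close> is integrable. The
  cumulants depend only on values near 0; for the beta-exponential distribution with parameters
  \<open>a\<close> and \<open>b\<close> integrability holds for all \<open>t < b\<close>.
\<close>

definition cumulant_generating :: "'a measure \<Rightarrow> ('a \<Rightarrow> real) \<Rightarrow> real \<Rightarrow> real" where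
  "cumulant_generating M X t = ln (\<integral>\<omega>. exp (t * X \<omega>) \<partial>M)"

definition cumulant :: "'a measure \<Rightarrow> ('a \<Rightarrow> real) \<Rightarrow> nat \<Rightarrow> real" where
  "cumulant M X n = (deriv ^^ n) (cumulant_generating M X) 0"

text \<open>
  This is only used for \<open>n \<ge> 1\<close>. The parameters \<open>a\<close> and \<open>b\<close> enter through the law of \<open>X\<close>, on
  which alone the cumulants depend.
\<close>

definition f_BE :: "'a measure \<Rightarrow> ('a \<Rightarrow> real) \<Rightarrow> nat \<Rightarrow> real" where
  "f_BE M X n = (cumulant M X n / fact (n - 1)) powr (1 / real n)"

end

theory Submission
  imports Defs
begin

text \<open>
  Since \<open>\<kappa>\<^sub>n / (n - 1)!\<close> is a difference of polygamma values, it equals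
  \<open>\<Sum>k. 1 / (b + k)^n - 1 / (a + b + k)^n\<close>. If \<open>p k\<close> and \<open>q k\<close> denote the two terms for the
  exponent \<open>n\<close>, then passing to an exponent \<open>m > n\<close> applies the strictly convex map
  \<open>\<phi> t = t powr (m / n)\<close> to each of them. The tail sums satisfy \<open>T k - T (k + 1) = p k - q k\<close>, and
  comparison with the telescoping case \<open>a = 1\<close> gives \<open>T (k + 1) < p (k + 1) < q k\<close> for \<open>a < 1\<close>, with
  both inequalities reversed for \<open>a > 1\<close>. Convexity thus compares \<open>\<phi> (T k) - \<phi> (T (k + 1))\<close> with
  \<open>\<phi> (p k) - \<phi> (q k)\<close>, and summation over \<open>k\<close> compares \<open>\<phi> (T 0)\<close> with the sum for \<open>m\<close>.
\<close>

section \<open>Strict convexity of real powers and telescoping sums\<close>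

lemma powr_increment_strict_mono:
  fixes r x y d :: real
  assumes "r > 1" "0 < x" "x < y" "0 < d"
  shows "(x + d) powr r - x powr r < (y + d) powr r - y powr r"
proof (rule DERIV_pos_imp_increasing[OF \<open>x < y\<close>])
  fix s assume s: "x \<le> s" "s \<le> y"
  have "((\<lambda>s. (s + d) powr r - s powr r) has_real_derivative
          r * (s + d) powr (r - 1) - r * s powr (r - 1)) (at s)"
    using assms s by (auto intro!: derivative_eq_intros)
  moreover have "s powr (r - 1) < (s + d) powr (r - 1)"
    using assms s by (intro powr_less_mono2) auto
  ultimately show "\<exists>D. ((\<lambda>s. (s + d) powr r - s powr r) has_real_derivative D) (at s) \<and> 0 < D"
    using assms by (intro exI[of _ "r * (s + d) powr (r - 1) - r * s powr (r - 1)"] conjI) auto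
qed

lemma powr_tail_sums:
  fixes T :: "nat \<Rightarrow> real"
  assumes "r > 1" "\<And>k. T k > 0" "T \<longlonglongrightarrow> 0"
  shows "(\<lambda>k. T k powr r - T (Suc k) powr r) sums (T 0 powr r)"
proof -
  have "(\<lambda>k. T k powr r) \<longlonglongrightarrow> 0 powr r"
    \<comment> \<open>The limit of the base is 0, where \<open>powr\<close> need not be continuous;
      nonnegativity of \<open>T\<close> and the positive exponent make up for this.\<close>
    using assms by (intro tendsto_powr2) (auto intro!: always_eventually less_imp_le)
  with telescope_sums'[of "\<lambda>k. T k powr r" 0] show ?thesis by simp
qed

lemma sums_strict_mono:
  fixes f g :: "nat \<Rightarrow> real"
  assumes "f sums s" "g sums t" "\<And>k. f k < g k"
  shows "s < t"
  using suminf_pos[of "\<lambda>k. g k - f k"] sums_diff[OF assms(2,1)] assms(3)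
  by (auto simp: sums_iff)

text \<open>The intervals from \<open>T (Suc k)\<close> to \<open>T k\<close> and from
  \<open>q k\<close> to \<open>p k\<close> have equal length, and the first lies further left. A
  strictly convex power therefore grows less over it; the increments over the first kind telescope
  to \<open>T 0 powr r\<close>.\<close>

lemma powr_tail_less:
  fixes T p q :: "nat \<Rightarrow> real"
  assumes "r > 1" "\<And>k. T k > 0" "T \<longlonglongrightarrow> 0"
    and "\<And>k. T k - T (Suc k) = p k - q k" "\<And>k. q k < p k"
    and "\<And>k. T (Suc k) < q k" "(\<lambda>k. p k powr r - q k powr r) sums S"
  shows "T 0 powr r < S"
proof (rule sums_strict_mono[OF powr_tail_sums[OF assms(1-3)] assms(7)])
  fix k
  have "(T (Suc k) + (p k - q k)) powr r - T (Suc k) powr r < (q k + (p k - q k)) powr r - q k powr r"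
    by (intro powr_increment_strict_mono) (simp_all add: assms)
  moreover have "T (Suc k) + (p k - q k) = T k" using assms(4)[of k] by simp
  ultimately show "T k powr r - T (Suc k) powr r < p k powr r - q k powr r" by simp
qed

text \<open>The mirror image: the interval from \<open>q k\<close> to \<open>p k\<close> now lies
  further left, so its left end has to be positive for the convexity argument.\<close>

lemma powr_tail_greater:
  fixes T p q :: "nat \<Rightarrow> real"
  assumes "r > 1" "\<And>k. T k > 0" "T \<longlonglongrightarrow> 0"
    and "\<And>k. T k - T (Suc k) = p k - q k" "\<And>k. 0 < q k" "\<And>k. q k < p k"
    and "\<And>k. q k < T (Suc k)" "(\<lambda>k. p k powr r - q k powr r) sums S"
  shows "S < T 0 powr r"
proof (rule sums_strict_mono[OF assms(8) powr_tail_sums[OF assms(1-3)]])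
  fix k
  have "(q k + (p k - q k)) powr r - q k powr r < (T (Suc k) + (p k - q k)) powr r - T (Suc k) powr r"
    by (intro powr_increment_strict_mono) (simp_all add: assms)
  moreover have "T (Suc k) + (p k - q k) = T k" using assms(4)[of k] by simp
  ultimately show "p k powr r - q k powr r < T k powr r - T (Suc k) powr r" by simp
qed

section \<open>Differences of Hurwitz zeta values\<close>

text \<open>
  The difference \<open>\<zeta>(n, x) - \<zeta>(n, x + a)\<close> of two Hurwitz zeta values, which also makes sense for \<open>n = 1\<close>.
\<close>

definition hurwitz_diff :: "real \<Rightarrow> nat \<Rightarrow> real \<Rightarrow> real" where
  "hurwitz_diff a n x = (\<Sum>k. inverse ((x + real k) ^ n) - inverse ((x + a + real k) ^ n))"

text \<open>For m > 0 the two polygamma series converge separately. For m = 0 they diverge like the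
  harmonic series, so the \<open>Digamma\<close> series with its correction 1/(k + 1) is used; the
  corrections and the Euler-Mascheroni constants cancel in the difference.\<close>

lemma Polygamma_diff_sums:
  fixes x y :: real
  assumes "x > 0" "y > 0"
  shows "(\<lambda>k. inverse ((x + real k) ^ Suc m) - inverse ((y + real k) ^ Suc m)) sums
           ((- 1) ^ Suc m * (Polygamma m x - Polygamma m y) / fact m)"
proof (cases "m = 0")
  case True
  have "(\<lambda>k. inverse (real (Suc k)) - inverse (z + real k)) sums (Digamma z + euler_mascheroni)"
    if "z > 0" for z :: real
    using summable_sums[OF summable_Digamma[of z]] that by (simp add: Digamma_def)
  from sums_diff[OF this[OF \<open>y > 0\<close>] this[OF \<open>x > 0\<close>]] show ?thesis
    using True by simp
next
  case False
  with assms sums_diff[OF Polygamma_LIMSEQ[of x m] Polygamma_LIMSEQ[of y m]] show ?thesis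
    by (simp add: algebra_simps diff_divide_distrib)
qed

lemma hurwitz_diff_sums:
  assumes "x > 0" "a > 0" "n > 0"
  shows "(\<lambda>k. inverse ((x + real k) ^ n) - inverse ((x + a + real k) ^ n)) sums hurwitz_diff a n x"
  using Polygamma_diff_sums[of x "x + a" "n - 1"] assms
  by (auto simp: hurwitz_diff_def intro: summable_sums sums_summable)

lemma hurwitz_diff_eq_Polygamma:
  assumes "x > 0" "a > 0"
  shows "fact m * hurwitz_diff a (Suc m) x =
           (- 1) ^ Suc m * (Polygamma m x - Polygamma m (x + a))"
  using sums_unique2[OF hurwitz_diff_sums[of x a "Suc m"] Polygamma_diff_sums[of x "x + a" m]] assms
  by simp

lemma hurwitz_diff_pos:
  assumes "x > 0" "a > 0" "n > 0"
  shows "hurwitz_diff a n x > 0"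
  by (rule sums_strict_mono[OF sums_zero hurwitz_diff_sums[OF assms]])
     (use assms in \<open>auto intro!: power_strict_mono\<close>)

lemma hurwitz_diff_strict_mono:
  assumes "x > 0" "0 < a" "a < a'" "n > 0"
  shows "hurwitz_diff a n x < hurwitz_diff a' n x"
  by (rule sums_strict_mono[OF hurwitz_diff_sums hurwitz_diff_sums])
     (use assms in \<open>auto intro!: power_strict_mono\<close>)

lemma hurwitz_diff_shift:
  assumes "x > 0" "a > 0" "n > 0"
  shows "hurwitz_diff a n x - hurwitz_diff a n (x + 1) = inverse (x ^ n) - inverse ((x + a) ^ n)"
  using suminf_split_head[OF sums_summable[OF hurwitz_diff_sums[OF assms]]]
  by (simp add: hurwitz_diff_def add_ac)

text \<open>Shifting the argument by k leaves the tail of the same convergent series from index k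
  on.\<close>

lemma hurwitz_diff_tendsto_0:
  assumes "x > 0" "a > 0" "n > 0"
  shows "(\<lambda>k. hurwitz_diff a n (x + real k)) \<longlonglongrightarrow> 0"
  using suminf_exist_split2[OF sums_summable[OF hurwitz_diff_sums[OF assms]]]
  by (simp add: hurwitz_diff_def add_ac)

text \<open>With a = 1 the subtracted term is the leading term at the next index, so the series
  telescopes.\<close>

lemma hurwitz_diff_1:
  assumes "x > 0" "n > 0"
  shows "hurwitz_diff 1 n x = inverse (x ^ n)"
proof -
  have "(\<lambda>k. inverse ((x + real k) ^ n)) \<longlonglongrightarrow> 0"
    using assms
    by (intro tendsto_inverse_0_at_top filterlim_pow_at_top
          filterlim_tendsto_add_at_top[OF tendsto_const] filterlim_real_sequentially)
  from telescope_sums'[OF this] hurwitz_diff_sums[of x 1 n] assms show ?thesis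
    by (auto simp: add_ac intro: sums_unique2)
qed

section \<open>Comparison of two exponents n < m\<close>

lemma inverse_power_powr_divide:
  fixes y :: real
  assumes "y > 0" "n > 0"
  shows "inverse (y ^ n) powr (real m / real n) = inverse (y ^ m)"
  using assms by (simp add: powr_realpow[symmetric] powr_minus[symmetric] powr_powr)

lemma hurwitz_diff_powr_less:
  assumes "b > 0" "0 < a" "a < 1" "0 < n" "n < m"
  shows "hurwitz_diff a n b powr (real m / real n) < hurwitz_diff a m b"
proof -
  have "hurwitz_diff a n (b + real (Suc k)) < inverse ((b + a + real k) ^ n)" for k
  proof -
    have "hurwitz_diff a n (b + real (Suc k)) < inverse ((b + real (Suc k)) ^ n)"
      using hurwitz_diff_strict_mono[of "b + real (Suc k)" a 1 n] assms
        hurwitz_diff_1[of "b + real (Suc k)" n] by simp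
    \<comment> \<open>Here a < 1 enters a second time, as b + a + k < b + k + 1.\<close>
    also have "\<dots> < inverse ((b + a + real k) ^ n)"
      using assms by (intro less_imp_inverse_less power_strict_mono) auto
    finally show ?thesis .
  qed
  moreover have "hurwitz_diff a n (b + real k) - hurwitz_diff a n (b + real (Suc k))
      = inverse ((b + real k) ^ n) - inverse ((b + a + real k) ^ n)" for k
    using hurwitz_diff_shift[of "b + real k" a n] assms by (simp add: add_ac)
  \<comment> \<open>The power m/n turns each term of the series for n into the corresponding term
    for m.\<close>
  moreover have "(\<lambda>k. inverse ((b + real k) ^ n) powr (real m / real n)
      - inverse ((b + a + real k) ^ n) powr (real m / real n)) sums hurwitz_diff a m b"
    using hurwitz_diff_sums[of b a m] assms by (simp add: inverse_power_powr_divide)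
  ultimately have "hurwitz_diff a n (b + real 0) powr (real m / real n) < hurwitz_diff a m b"
    using assms
    by (intro powr_tail_less[where p = "\<lambda>k. inverse ((b + real k) ^ n)"
          and q = "\<lambda>k. inverse ((b + a + real k) ^ n)" and T = "\<lambda>k. hurwitz_diff a n (b + real k)"]
        hurwitz_diff_tendsto_0 hurwitz_diff_pos less_imp_inverse_less power_strict_mono) auto
  then show ?thesis by simp
qed

lemma hurwitz_diff_powr_greater:
  assumes "b > 0" "a > 1" "0 < n" "n < m"
  shows "hurwitz_diff a m b < hurwitz_diff a n b powr (real m / real n)"
proof -
  have "inverse ((b + a + real k) ^ n) < hurwitz_diff a n (b + real (Suc k))" for k
  proof -
    have "inverse ((b + a + real k) ^ n) < inverse ((b + real (Suc k)) ^ n)"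
      using assms by (intro less_imp_inverse_less power_strict_mono) auto
    also have "\<dots> < hurwitz_diff a n (b + real (Suc k))"
      using hurwitz_diff_strict_mono[of "b + real (Suc k)" 1 a n] assms
        hurwitz_diff_1[of "b + real (Suc k)" n] by simp
    finally show ?thesis .
  qed
  moreover have "hurwitz_diff a n (b + real k) - hurwitz_diff a n (b + real (Suc k))
      = inverse ((b + real k) ^ n) - inverse ((b + a + real k) ^ n)" for k
    using hurwitz_diff_shift[of "b + real k" a n] assms by (simp add: add_ac)
  moreover have "(\<lambda>k. inverse ((b + real k) ^ n) powr (real m / real n)
      - inverse ((b + a + real k) ^ n) powr (real m / real n)) sums hurwitz_diff a m b"
    using hurwitz_diff_sums[of b a m] assms by (simp add: inverse_power_powr_divide)
  ultimately have "hurwitz_diff a m b < hurwitz_diff a n (b + real 0) powr (real m / real n)"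
    using assms
    by (intro powr_tail_greater[where p = "\<lambda>k. inverse ((b + real k) ^ n)"
          and q = "\<lambda>k. inverse ((b + a + real k) ^ n)" and T = "\<lambda>k. hurwitz_diff a n (b + real k)"]
        hurwitz_diff_tendsto_0 hurwitz_diff_pos less_imp_inverse_less power_strict_mono) auto
  then show ?thesis by simp
qed

section \<open>Moment-generating function and cumulants of the beta-exponential law\<close>

lemma beta_exponential_integral:
  fixes a c :: real
  assumes "a > 0" "c > 0"
  shows "(LBINT x:{0<..}. (1 - exp (- x)) powr (a - 1) * exp (- c * x)) = Beta a c"
proof -
  let ?f = "\<lambda>x::real. (1 - exp (- x)) powr (a - 1) * exp (- c * x)"
  \<comment> \<open>\<open>?g\<close> inverts v = 1 - exp (-x), so substituting x =
    \<open>?g v\<close> leads to the classical Beta integral \<open>?h\<close>.\<close>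
  let ?g = "\<lambda>v::real. - ln (1 - v)"
  let ?h = "\<lambda>v::real. v powr (a - 1) * (1 - v) powr (c - 1)"
  have h: "(?h has_integral Beta a c) {0<..<1}"
    using has_integral_Beta_real[OF assms] by (simp add: has_integral_Icc_iff_Ioo)
  \<comment> \<open>Nonnegativity of \<open>?h\<close> upgrades the gauge integral to absolute
    integrability; measurability of \<open>?h\<close> then allows passing from the completed measure
    to \<open>lborel\<close>.\<close>
  then have abs_int: "?h absolutely_integrable_on {0<..<1}"
    by (subst absolutely_integrable_on_iff_nonneg) auto
  have int: "set_integrable lborel {0<..<1} ?h"
    using abs_int unfolding set_integrable_def by (subst (asm) integrable_completion) auto
  have eq: "?f (?g v) * (1 / (1 - v)) = ?h v" if "0 < v" "v < 1" for v
  proof -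
    have "exp (- c * ?g v) = (1 - v) powr c" using that by (simp add: powr_def)
    moreover have "(1 - v) powr c * (1 / (1 - v)) = (1 - v) powr (c - 1)"
      using that by (simp add: powr_diff)
    ultimately show ?thesis using that by (simp add: exp_minus flip: times_divide_eq_right)
  qed
  have ein: "einterval 0 1 = {0<..<1::real}" "einterval 0 \<infinity> = {0<..}"
    by (auto simp: einterval_def)
  have "(LBINT x=0..\<infinity>. ?f x) = (LBINT v=0..1. (?f (?g v) * (1 / (1 - v))))"
  proof (rule interval_integral_substitution_nonneg(2))
    show "((ereal \<circ> ?g \<circ> real_of_ereal) \<longlongrightarrow> 0) (at_right 0)"
      unfolding zero_ereal_def ereal_tendsto_simps
      by (rule tendsto_eq_intros refl | simp)+
    show "((ereal \<circ> ?g \<circ> real_of_ereal) \<longlongrightarrow> \<infinity>) (at_left 1)"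
      unfolding one_ereal_def ereal_tendsto_simps filterlim_uminus_at_top minus_minus
      by (intro filterlim_compose[OF ln_at_0])
         (auto simp: filterlim_at eventually_at_filter intro!: tendsto_eq_intros)
    show "set_integrable lborel (einterval 0 1) (\<lambda>v. ?f (?g v) * (1 / (1 - v)))"
      unfolding ein using int eq by (subst set_integrable_cong) auto
  qed (auto intro!: derivative_eq_intros continuous_intros simp: field_simps)
  also have "\<dots> = (LBINT v:{0<..<1}. ?h v)"
    unfolding interval_lebesgue_integral_def ein
    using eq by (auto intro!: set_lebesgue_integral_cong)
  also have "\<dots> = Beta a c"
    using set_borel_integral_eq_integral(2)[OF int] h by (simp add: integral_unique)
  finally show ?thesis by (simp add: interval_lebesgue_integral_def ein)
qed

lemma beta_exponential_mgf:
  assumes "a > 0" "b > 0" "t < b"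
    and "distributed M lborel X (\<lambda>x. ennreal (beta_exponential_density a b x))"
  shows "(\<integral>\<omega>. exp (t * X \<omega>) \<partial>M) = Beta a (b - t) / Beta a b"
proof -
  \<comment> \<open>Positivity of the normalising constant makes the density nonnegative, as
    \<open>distributed_integral\<close> demands.\<close>
  have B: "Beta a b > 0" using assms by (simp add: Beta_def Gamma_real_pos)
  have "(\<integral>\<omega>. exp (t * X \<omega>) \<partial>M) = (\<integral>x. beta_exponential_density a b x * exp (t * x) \<partial>lborel)"
    by (rule distributed_integral[OF assms(4), symmetric])
       (use B in \<open>auto simp: beta_exponential_density_def\<close>)
  also have "\<dots> = (LBINT x:{0<..}. (1 - exp (- x)) powr (a - 1) * exp (- (b - t) * x)) / Beta a b"
    unfolding set_lebesgue_integral_def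
    by (subst Bochner_Integration.integral_divide_zero[symmetric], rule Bochner_Integration.integral_cong)
       (auto simp: beta_exponential_density_def exp_add[symmetric] algebra_simps indicator_def)
  finally show ?thesis using beta_exponential_integral[of a "b - t"] assms by simp
qed

lemma beta_exponential_cumulant:
  assumes "a > 0" "b > 0"
    and "distributed M lborel X (\<lambda>x. ennreal (beta_exponential_density a b x))"
  shows "cumulant M X (Suc m) = fact m * hurwitz_diff a (Suc m) b"
proof -
  have K: "cumulant_generating M X t =
      ln_Gamma (b - t) - ln_Gamma (b - t + a) - ln_Gamma b + ln_Gamma (a + b)" if "t < b" for t
  proof -
    have "Gamma x \<noteq> 0" if "x > 0" for x :: real
      using Gamma_real_pos[OF that] by simp
    then show ?thesis
      using assms that
      by (simp add: cumulant_generating_def beta_exponential_mgf Beta_def ln_div ln_mult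
          ln_Gamma_real_pos add_ac)
  qed
  \<comment> \<open>The claim covers all t < b, not just t = 0: each further derivative needs the
    previous formula on a neighbourhood, which the open set \<open>{..<b}\<close> supplies. Each
    differentiation in t contributes a factor -1 through b - t.\<close>
  have "(deriv ^^ Suc m) (cumulant_generating M X) t =
      (- 1) ^ Suc m * (Polygamma m (b - t) - Polygamma m (b - t + a))" if "t < b" for t
    using that
  proof (induction m arbitrary: t)
    case 0
    have "deriv (cumulant_generating M X) t =
        deriv (\<lambda>t. ln_Gamma (b - t) - ln_Gamma (b - t + a) - ln_Gamma b + ln_Gamma (a + b)) t"
      using K eventually_nhds_in_open[of "{..<b}" t] 0
      by (intro deriv_cong_ev) (auto elim!: eventually_mono)
    also have "\<dots> = - Digamma (b - t) + Digamma (b - t + a)"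
      using 0 assms by (intro DERIV_imp_deriv) (auto intro!: derivative_eq_intros)
    finally show ?case by simp
  next
    case (Suc m)
    have "(deriv ^^ Suc (Suc m)) (cumulant_generating M X) t =
        deriv (\<lambda>t. (- 1) ^ Suc m * (Polygamma m (b - t) - Polygamma m (b - t + a))) t"
      using eventually_nhds_in_open[of "{..<b}" t] Suc
      by (subst funpow.simps(2), subst o_apply, intro deriv_cong_ev)
         (auto elim!: eventually_mono simp del: funpow.simps)
    also have "\<dots> = (- 1) ^ Suc m * (- Polygamma (Suc m) (b - t) + Polygamma (Suc m) (b - t + a))"
      using Suc.prems assms nonpos_Ints_subset_nonpos_Reals
      by (intro DERIV_imp_deriv)
         (auto intro!: derivative_eq_intros dest!: nonpos_Ints_nonpos simp del: power_Suc)
    finally show ?case by (simp add: algebra_simps)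
  qed
  from this[of 0] show ?thesis
    using assms by (simp add: cumulant_def hurwitz_diff_eq_Polygamma)
qed

section \<open>Monotonicity of \<open>f_BE\<close> in n\<close>

lemma f_BE_eq_hurwitz_diff:
  assumes "a > 0" "b > 0" "n > 0"
    and "distributed M lborel X (\<lambda>x. ennreal (beta_exponential_density a b x))"
  shows "f_BE M X n = hurwitz_diff a n b powr (1 / real n)"
  using beta_exponential_cumulant[OF assms(1,2,4), of "n - 1"] assms(3) by (simp add: f_BE_def)

theorem corollary1:
  fixes a b :: real and M :: "'a measure" and X :: "'a \<Rightarrow> real"
  assumes "a > 0" and "b > 0"
    and "prob_space M"
    and "distributed M lborel X (\<lambda>x. ennreal (beta_exponential_density a b x))"
  shows "(a < 1 \<longrightarrow> strict_mono_on {1..} (f_BE M X)) \<and>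
         (a > 1 \<longrightarrow> strict_antimono_on {1..} (f_BE M X)) \<and>
         (a = 1 \<longrightarrow> (\<forall>n\<ge>1. f_BE M X n = 1 / b))"
proof (intro conjI impI allI)
  note f = f_BE_eq_hurwitz_diff[OF assms(1,2) _ assms(4)]
  \<comment> \<open>Taking m-th roots turns the comparison of powers into one between
    \<open>f_BE M X n\<close> and \<open>f_BE M X m\<close>.\<close>
  have root: "(hurwitz_diff a n b powr (real m / real n)) powr (1 / real m) = f_BE M X n"
    if "0 < n" "0 < m" for n m
    using that by (simp add: f powr_powr)
  show "strict_mono_on {1..} (f_BE M X)" if "a < 1"
  proof (rule strict_mono_onI)
    fix n m :: nat assume nm: "n \<in> {1..}" "m \<in> {1..}" "n < m"
    then have "(hurwitz_diff a n b powr (real m / real n)) powr (1 / real m)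
        < hurwitz_diff a m b powr (1 / real m)"
      using hurwitz_diff_powr_less[of b a n m] assms that by (intro powr_less_mono2) auto
    with nm show "f_BE M X n < f_BE M X m" by (simp add: root f)
  qed
  show "strict_antimono_on {1..} (f_BE M X)" if "a > 1"
  proof (rule monotone_onI)
    fix n m :: nat assume nm: "n \<in> {1..}" "m \<in> {1..}" "n < m"
    then have "hurwitz_diff a m b powr (1 / real m)
        < (hurwitz_diff a n b powr (real m / real n)) powr (1 / real m)"
      using hurwitz_diff_powr_greater[of b a n m] hurwitz_diff_pos[of b a m] assms that
      by (intro powr_less_mono2) auto
    with nm show "f_BE M X n > f_BE M X m" by (simp add: root f)
  qed
  show "f_BE M X n = 1 / b" if "a = 1" "n \<ge> 1" for n
    using that assms inverse_power_powr_divide[of b n 1] f[of n]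
    by (simp add: hurwitz_diff_1 inverse_eq_divide)
qed

end
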